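(* Consider an ergodic time-reversible Markov chain on a finite state space $\Omega$ with transition probabilities $P$ and stationary distribution $\pi$, and let $\Omega=\Omega_0\cup\cdots\cup\Omega_{m-1}$ be a partition of $\Omega$ into $m$ disjoint blocks, with induced projection chain $(\overline P,\bar\pi)$ on $[m]=\{0,\dots,m-1\}$ and restriction chains $(P_i,\pi_i)$ on $\Omega_i$, $i\in[m]$. Suppose the projection chain satisfies a log-Sobolev inequality with constant $\bar\alpha>0$, and that every restriction chain ($i\in[m]$) satisfies a log-Sobolev inequality with the uniform constant $\alpha_{\min}>0$. Let $$\gamma := \max_{i \in [m]} \max_{x \in \Omega_i} \sum_{y \in \Omega \setminus \Omega_i} P(x, y).$$ Then the original Markov chain satisfies a log-Sobolev inequality with constant $$\alpha := \min\left\{\frac{\bar{\alpha}}{3}, \frac{\bar{\alpha}\alpha_{\min}}{3\gamma + \bar{\alpha}}\right\},$$ i.e. $\mathcal{E}_\pi(f,f)\ge \alpha\,\mathcal{L}_\pi(f)$ for all $f:\Omega\to\mathbb{R}$.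
   Context: Time-reversible means $\pi(x)P(x,y)=\pi(y)P(y,x)$ for all $x,y\in\Omega$. Blocks of a partition are nonempty. Projection chain: the Markov chain on $[m]$ with $\bar\pi(i)=\sum_{x\in\Omega_i}\pi(x)$ and $\overline P(i,j)=\bar\pi(i)^{-1}\sum_{x\in\Omega_i,\,y\in\Omega_j}\pi(x)P(x,y)$; it is time-reversible with stationary distribution $\bar\pi$. Restriction chain on $\Omega_i$: $P_i(x,y)=P(x,y)$ for $x\neq y$ in $\Omega_i$ and $P_i(x,x)=1-\sum_{z\in\Omega_i\setminus\{x\}}P(x,z)$; it is time-reversible with stationary distribution $\pi_i(x)=\pi(x)/\bar\pi(i)$. For a chain with transition probabilities $Q$ and stationary distribution $\mu$ on a finite set $S$, and $f:S\to\mathbb{R}$: $\mathrm{E}_\mu f=\sum_{x}\mu(x)f(x)$, the Dirichlet form is $\mathcal{E}_\mu(f,f)=\frac12\sum_{x,y\in S}\mu(x)Q(x,y)(f(x)-f(y))^2$ (so $\mathcal{E}_\pi$, $\mathcal{E}_{\bar\pi}$, $\mathcal{E}_{\pi_i}$ use $P$, $\overline P$, $P_i$ respectively), and $\mathcal{L}_\mu(f)=\mathrm{E}_\mu[f^2(\ln f^2-\ln(\mathrm{E}_\mu f^2))]$, with the usual convention that terms with $f(x)=0$ contribute $0$. The chain satisfies a log-Sobolev inequality with constant $\kappa$ if $\mathcal{E}_\mu(f,f)\ge\kappa\,\mathcal{L}_\mu(f)$ for all $f:S\to\mathbb{R}$. *)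

theory Defs
  imports Complex_Main "HOL-Library.Disjoint_Sets"
begin

text \<open>Finite Markov chains are given by an explicit state space \<open>S\<close>, transition probabilities
  \<open>P\<close> and a distribution \<open>\<mu>\<close>; values of \<open>P\<close>, \<open>\<mu>\<close> and of test functions outside \<open>S\<close> are irrelevant.\<close>

definition transition_matrix :: "'a set \<Rightarrow> ('a \<Rightarrow> 'a \<Rightarrow> real) \<Rightarrow> bool" where
  "transition_matrix S P \<longleftrightarrow>
     finite S \<and> S \<noteq> {} \<and> (\<forall>x\<in>S. \<forall>y\<in>S. 0 \<le> P x y) \<and> (\<forall>x\<in>S. (\<Sum>y\<in>S. P x y) = 1)"

definition stationary_distribution ::
  "'a set \<Rightarrow> ('a \<Rightarrow> real) \<Rightarrow> ('a \<Rightarrow> 'a \<Rightarrow> real) \<Rightarrow> bool" where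
  "stationary_distribution S \<mu> P \<longleftrightarrow>
     (\<forall>x\<in>S. 0 \<le> \<mu> x) \<and> (\<Sum>x\<in>S. \<mu> x) = 1 \<and> (\<forall>y\<in>S. (\<Sum>x\<in>S. \<mu> x * P x y) = \<mu> y)"

definition time_reversible ::
  "'a set \<Rightarrow> ('a \<Rightarrow> real) \<Rightarrow> ('a \<Rightarrow> 'a \<Rightarrow> real) \<Rightarrow> bool" where
  "time_reversible S \<mu> P \<longleftrightarrow> (\<forall>x\<in>S. \<forall>y\<in>S. \<mu> x * P x y = \<mu> y * P y x)"

primrec step_prob :: "'a set \<Rightarrow> ('a \<Rightarrow> 'a \<Rightarrow> real) \<Rightarrow> nat \<Rightarrow> 'a \<Rightarrow> 'a \<Rightarrow> real" where
  "step_prob S P 0 x y = (if x = y then 1 else 0)"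
| "step_prob S P (Suc n) x y = (\<Sum>z\<in>S. P x z * step_prob S P n z y)"

definition irreducible_chain :: "'a set \<Rightarrow> ('a \<Rightarrow> 'a \<Rightarrow> real) \<Rightarrow> bool" where
  "irreducible_chain S P \<longleftrightarrow> (\<forall>x\<in>S. \<forall>y\<in>S. \<exists>n. 0 < step_prob S P n x y)"

definition aperiodic_chain :: "'a set \<Rightarrow> ('a \<Rightarrow> 'a \<Rightarrow> real) \<Rightarrow> bool" where
  "aperiodic_chain S P \<longleftrightarrow> (\<forall>x\<in>S. Gcd {n. 0 < n \<and> 0 < step_prob S P n x x} = 1)"

definition ergodic_chain :: "'a set \<Rightarrow> ('a \<Rightarrow> 'a \<Rightarrow> real) \<Rightarrow> bool" where
  "ergodic_chain S P \<longleftrightarrow> irreducible_chain S P \<and> aperiodic_chain S P"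

text \<open>A partition is indexed: its blocks are \<open>B 0, \<dots>, B (m - 1)\<close>.\<close>

definition block_partition :: "'a set \<Rightarrow> nat \<Rightarrow> (nat \<Rightarrow> 'a set) \<Rightarrow> bool" where
  "block_partition S m B \<longleftrightarrow>
     (\<Union>i<m. B i) = S \<and> disjoint_family_on B {..<m} \<and> (\<forall>i<m. B i \<noteq> {})"

definition proj_dist :: "('a \<Rightarrow> real) \<Rightarrow> (nat \<Rightarrow> 'a set) \<Rightarrow> nat \<Rightarrow> real" where
  "proj_dist \<mu> B i = (\<Sum>x\<in>B i. \<mu> x)"

definition proj_trans ::
  "('a \<Rightarrow> real) \<Rightarrow> ('a \<Rightarrow> 'a \<Rightarrow> real) \<Rightarrow> (nat \<Rightarrow> 'a set) \<Rightarrow> nat \<Rightarrow> nat \<Rightarrow> real" where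
  "proj_trans \<mu> P B i j = inverse (proj_dist \<mu> B i) * (\<Sum>x\<in>B i. \<Sum>y\<in>B j. \<mu> x * P x y)"

definition restr_dist :: "('a \<Rightarrow> real) \<Rightarrow> (nat \<Rightarrow> 'a set) \<Rightarrow> nat \<Rightarrow> 'a \<Rightarrow> real" where
  "restr_dist \<mu> B i x = \<mu> x / proj_dist \<mu> B i"

definition restr_trans ::
  "('a \<Rightarrow> 'a \<Rightarrow> real) \<Rightarrow> (nat \<Rightarrow> 'a set) \<Rightarrow> nat \<Rightarrow> 'a \<Rightarrow> 'a \<Rightarrow> real" where
  "restr_trans P B i x y = (if x = y then 1 - (\<Sum>z\<in>B i - {x}. P x z) else P x y)"

definition expect :: "'a set \<Rightarrow> ('a \<Rightarrow> real) \<Rightarrow> ('a \<Rightarrow> real) \<Rightarrow> real" where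
  "expect S \<mu> f = (\<Sum>x\<in>S. \<mu> x * f x)"

definition dirichlet_form ::
  "'a set \<Rightarrow> ('a \<Rightarrow> real) \<Rightarrow> ('a \<Rightarrow> 'a \<Rightarrow> real) \<Rightarrow> ('a \<Rightarrow> real) \<Rightarrow> real" where
  "dirichlet_form S \<mu> Q f = 1 / 2 * (\<Sum>x\<in>S. \<Sum>y\<in>S. \<mu> x * Q x y * (f x - f y)\<^sup>2)"

text \<open>Terms with \<open>f x = 0\<close> vanish because of the factor \<open>(f x)\<^sup>2\<close>, whatever the value of \<open>ln 0\<close>.\<close>

definition entropy_form :: "'a set \<Rightarrow> ('a \<Rightarrow> real) \<Rightarrow> ('a \<Rightarrow> real) \<Rightarrow> real" where
  "entropy_form S \<mu> f =
     expect S \<mu> (\<lambda>x. (f x)\<^sup>2 * (ln ((f x)\<^sup>2) - ln (expect S \<mu> (\<lambda>z. (f z)\<^sup>2))))"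

definition log_sobolev ::
  "'a set \<Rightarrow> ('a \<Rightarrow> real) \<Rightarrow> ('a \<Rightarrow> 'a \<Rightarrow> real) \<Rightarrow> real \<Rightarrow> bool" where
  "log_sobolev S \<mu> Q \<kappa> \<longleftrightarrow> (\<forall>f. dirichlet_form S \<mu> Q f \<ge> \<kappa> * entropy_form S \<mu> f)"

end

theory Submission
  imports Defs
begin

text \<open>Let \<open>F i\<close> be the \<open>L\<^sup>2\<close> norm of \<open>f\<close> on block \<open>i\<close>. Entropy decomposes as
  \<open>L f = (\<Sum>i. \<pi>bar i * L i f) + Lbar F\<close>. The first term is controlled by the restriction chains.
  For the second, apply the projection chain's inequality to \<open>F\<close> and use, for \<open>x\<close> in block \<open>i\<close> and
  \<open>y\<close> in block \<open>j\<close>,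
  \<open>(F i - F j)\<^sup>2 \<le> 3 * ((F i - \<bar>f x\<bar>)\<^sup>2 + (f x - f y)\<^sup>2 + (F j - \<bar>f y\<bar>)\<^sup>2)\<close>.
  The middle terms give the part of the Dirichlet form between blocks; the outer ones, which by
  reversibility contribute equally, are at most \<open>\<gamma>\<close> times the mean of \<open>(F i - \<bar>f\<bar>)\<^sup>2\<close> over the
  blocks, and that mean is bounded by the entropy on the block because \<open>ln t \<le> t - 1\<close>.\<close>

section \<open>Sums over blocks and weights of blocks\<close>

definition block_norm :: "('a \<Rightarrow> real) \<Rightarrow> (nat \<Rightarrow> 'a set) \<Rightarrow> ('a \<Rightarrow> real) \<Rightarrow> nat \<Rightarrow> real" where
  "block_norm \<mu> B f i = sqrt (expect (B i) (restr_dist \<mu> B i) (\<lambda>x. (f x)\<^sup>2))"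

lemma block_partition_sum:
  fixes g :: "'a \<Rightarrow> real"
  assumes "finite S" and "block_partition S m B"
  shows "(\<Sum>x\<in>S. g x) = (\<Sum>i<m. \<Sum>x\<in>B i. g x)"
proof -
  have S: "S = (\<Union>i<m. B i)" and disj: "disjoint_family_on B {..<m}"
    using assms by (auto simp: block_partition_def)
  have "\<forall>i\<in>{..<m}. finite (B i)"
    using assms(1) unfolding S by (meson UN_upper finite_subset)
  then show ?thesis
    unfolding S using disj by (intro sum.UNION_disjoint) (auto simp: disjoint_family_on_def)
qed

lemma block_partition_sum_Diff:
  fixes g :: "'a \<Rightarrow> real"
  assumes "finite S" and "block_partition S m B" and "i < m"
  shows "(\<Sum>y\<in>S - B i. g y) = (\<Sum>j<m. if i = j then 0 else \<Sum>y\<in>B j. g y)"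
proof -
  have "B i \<subseteq> S" using assms by (auto simp: block_partition_def)
  then have "(\<Sum>y\<in>S - B i. g y) = (\<Sum>j<m. \<Sum>y\<in>B j. g y) - (\<Sum>y\<in>B i. g y)"
    using assms block_partition_sum[of S m B g] by (simp add: sum_diff)
  also have "\<dots> = (\<Sum>j\<in>{..<m} - {i}. \<Sum>y\<in>B j. g y)"
    using assms(3) by (simp add: sum_diff)
  also have "\<dots> = (\<Sum>j<m. if i = j then 0 else \<Sum>y\<in>B j. g y)"
    using assms(3) by (subst (2) sum.remove[of _ i]) (auto intro!: sum.cong)
  finally show ?thesis .
qed

text \<open>On a block of measure 0, nonnegativity forces \<open>\<mu> x = 0\<close>, which agrees
  with the default value 0 of division by zero. Hence the conversion between block weights and
  global weights is uniform in the block.\<close>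

lemma proj_dist_mult_restr_dist:
  assumes "finite (B i)" and "\<And>x. x \<in> B i \<Longrightarrow> 0 \<le> \<mu> x" and "x \<in> B i"
  shows "proj_dist \<mu> B i * restr_dist \<mu> B i x = \<mu> x"
proof (cases "proj_dist \<mu> B i = 0")
  case True
  then have "\<mu> x = 0"
    using assms by (auto simp: proj_dist_def sum_nonneg_eq_0_iff)
  then show ?thesis by (simp add: restr_dist_def)
qed (simp add: restr_dist_def)

lemma proj_dist_mult_expect:
  assumes "finite (B i)" and "\<And>x. x \<in> B i \<Longrightarrow> 0 \<le> \<mu> x"
  shows "proj_dist \<mu> B i * expect (B i) (restr_dist \<mu> B i) g = (\<Sum>x\<in>B i. \<mu> x * g x)"
  unfolding expect_def sum_distrib_left
  using assms by (intro sum.cong) (simp_all add: proj_dist_mult_restr_dist flip: mult.assoc)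

lemma proj_dist_mult_proj_trans:
  assumes "finite (B i)" and "\<And>x. x \<in> B i \<Longrightarrow> 0 \<le> \<mu> x"
  shows "proj_dist \<mu> B i * proj_trans \<mu> P B i j = (\<Sum>x\<in>B i. \<Sum>y\<in>B j. \<mu> x * P x y)"
proof (cases "proj_dist \<mu> B i = 0")
  case True
  then have "\<forall>x\<in>B i. \<mu> x = 0"
    using assms by (auto simp: proj_dist_def sum_nonneg_eq_0_iff)
  then show ?thesis by (simp add: True)
qed (simp add: proj_trans_def)

lemma block_norm_power2:
  assumes "\<And>x. x \<in> B i \<Longrightarrow> 0 \<le> \<mu> x"
  shows "(block_norm \<mu> B f i)\<^sup>2 = expect (B i) (restr_dist \<mu> B i) (\<lambda>x. (f x)\<^sup>2)"
  unfolding block_norm_def expect_def restr_dist_def proj_dist_def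
  using assms by (intro real_sqrt_pow2 sum_nonneg mult_nonneg_nonneg divide_nonneg_nonneg) auto

section \<open>Deviation from the block norm versus entropy\<close>

text \<open>The total mass may be smaller than \<open>1\<close>: a block of measure \<open>0\<close> has
  \<open>restr_dist \<mu> B i x = 0\<close>.\<close>

lemma deviation_le_entropy_form:
  fixes f :: "'a \<Rightarrow> real"
  assumes "finite S" and pos: "\<And>x. x \<in> S \<Longrightarrow> 0 \<le> \<mu> x" and "(\<Sum>x\<in>S. \<mu> x) \<le> 1"
  defines "F \<equiv> sqrt (expect S \<mu> (\<lambda>x. (f x)\<^sup>2))"
  shows "(\<Sum>x\<in>S. \<mu> x * (F - \<bar>f x\<bar>)\<^sup>2) \<le> entropy_form S \<mu> f"
proof -
  have E0: "0 \<le> expect S \<mu> (\<lambda>x. (f x)\<^sup>2)"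
    unfolding expect_def using pos by (intro sum_nonneg) auto
  then have F2: "expect S \<mu> (\<lambda>x. (f x)\<^sup>2) = F\<^sup>2" and F0: "0 \<le> F"
    by (auto simp: F_def)
  \<comment> \<open>This is \<open>ln t \<le> t - 1\<close> at
    \<open>t = F / \<bar>f x\<bar>\<close>, scaled by twice \<open>(f x)\<^sup>2\<close>.\<close>
  have pt: "\<mu> x * (2 * (f x)\<^sup>2 - 2 * F * \<bar>f x\<bar>) \<le> \<mu> x * ((f x)\<^sup>2 * (ln ((f x)\<^sup>2) - ln (F\<^sup>2)))"
    if x: "x \<in> S" for x
  \<comment> \<open>If the product vanishes, both sides are 0. Otherwise it is a positive summand of
    \<open>F\<^sup>2\<close>, so \<open>F > 0\<close> and the logarithm of \<open>F\<close> is
    genuine.\<close>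
  proof (cases "\<mu> x * (f x)\<^sup>2 = 0")
    case True
    then show ?thesis by auto
  next
    case False
    then have f: "\<bar>f x\<bar> > 0" by auto
    have "0 < \<mu> x * (f x)\<^sup>2" using False pos[OF x] by (simp add: less_le)
    also have "\<dots> \<le> F\<^sup>2"
      unfolding F2[symmetric] expect_def using assms(1) pos x by (intro member_le_sum) auto
    finally have F: "F > 0" using F0 by (simp add: less_le)
    have ln_f: "ln ((f x)\<^sup>2) = 2 * ln \<bar>f x\<bar>"
      using f ln_realpow[of "\<bar>f x\<bar>" 2] by simp
    have ln_F: "ln (F\<^sup>2) = 2 * ln F"
      using F ln_realpow[of F 2] by simp
    have "ln F - ln \<bar>f x\<bar> \<le> F / \<bar>f x\<bar> - 1"
      using ln_le_minus_one[of "F / \<bar>f x\<bar>"] F f by (simp add: ln_div)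
    then have "(f x)\<^sup>2 * (2 - 2 * (F / \<bar>f x\<bar>)) \<le> (f x)\<^sup>2 * (ln ((f x)\<^sup>2) - ln (F\<^sup>2))"
      unfolding ln_f ln_F by (intro mult_left_mono) auto
    moreover have "(f x)\<^sup>2 * (2 - 2 * (F / \<bar>f x\<bar>)) = 2 * (f x)\<^sup>2 - 2 * F * \<bar>f x\<bar>"
      using f by (simp add: field_simps power2_eq_square)
    ultimately show ?thesis using pos[OF x] by (simp add: mult_left_mono)
  qed
  have "(\<Sum>x\<in>S. \<mu> x * (F - \<bar>f x\<bar>)\<^sup>2)
      = F\<^sup>2 * (\<Sum>x\<in>S. \<mu> x) + (\<Sum>x\<in>S. \<mu> x * (f x)\<^sup>2) - 2 * F * (\<Sum>x\<in>S. \<mu> x * \<bar>f x\<bar>)"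
    by (simp add: sum_distrib_left power2_eq_square algebra_simps flip: sum.distrib sum_subtractf)
  also have "\<dots> \<le> F\<^sup>2 * 1 + (\<Sum>x\<in>S. \<mu> x * (f x)\<^sup>2) - 2 * F * (\<Sum>x\<in>S. \<mu> x * \<bar>f x\<bar>)"
    using assms(3) by (intro diff_right_mono add_right_mono mult_left_mono) auto
  \<comment> \<open>\<open>F\<^sup>2\<close> is itself the mean of the squares of \<open>f\<close>,
    so the first two terms merge into the shape that \<open>pt\<close> bounds.\<close>
  also have "\<dots> = 2 * (\<Sum>x\<in>S. \<mu> x * (f x)\<^sup>2) - 2 * F * (\<Sum>x\<in>S. \<mu> x * \<bar>f x\<bar>)"
    by (simp add: F2[unfolded expect_def])
  also have "\<dots> = (\<Sum>x\<in>S. \<mu> x * (2 * (f x)\<^sup>2 - 2 * F * \<bar>f x\<bar>))"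
    by (simp add: sum_distrib_left algebra_simps flip: sum_subtractf)
  also have "\<dots> \<le> (\<Sum>x\<in>S. \<mu> x * ((f x)\<^sup>2 * (ln ((f x)\<^sup>2) - ln (F\<^sup>2))))"
    by (intro sum_mono pt)
  also have "\<dots> = entropy_form S \<mu> f"
    by (simp only: entropy_form_def F2 expect_def[of _ _ "\<lambda>x. _ x * _ x"])
  finally show ?thesis .
qed

lemma block_deviation_le_entropy_form:
  assumes "finite (B i)" and pos: "\<And>x. x \<in> B i \<Longrightarrow> 0 \<le> \<mu> x"
  shows "(\<Sum>x\<in>B i. \<mu> x * (block_norm \<mu> B f i - \<bar>f x\<bar>)\<^sup>2)
    \<le> proj_dist \<mu> B i * entropy_form (B i) (restr_dist \<mu> B i) f"
proof -
  have p: "0 \<le> proj_dist \<mu> B i" unfolding proj_dist_def using pos by (rule sum_nonneg)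
  \<comment> \<open>The sum is 1, or 0 on a block of measure 0.\<close>
  have "(\<Sum>x\<in>B i. restr_dist \<mu> B i x) \<le> 1"
    by (simp add: restr_dist_def proj_dist_def flip: sum_divide_distrib)
  then have "expect (B i) (restr_dist \<mu> B i) (\<lambda>x. (block_norm \<mu> B f i - \<bar>f x\<bar>)\<^sup>2)
      \<le> entropy_form (B i) (restr_dist \<mu> B i) f"
    unfolding expect_def block_norm_def[unfolded expect_def]
    using deviation_le_entropy_form[of "B i" "restr_dist \<mu> B i" f] assms p
    by (simp add: expect_def restr_dist_def)
  from mult_left_mono[OF this p] show ?thesis
    using assms by (simp add: proj_dist_mult_expect)
qed

section \<open>Decomposition of entropy and Dirichlet form along the partition\<close>

text \<open>This is the chain rule for entropy: \<open>ln ((F i)\<^sup>2)\<close> is inserted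
  between the logarithm of the square of \<open>f x\<close> and that of the global mean.\<close>

lemma entropy_form_decomposition:
  assumes fin: "finite S" and part: "block_partition S m B" and pos: "\<And>x. x \<in> S \<Longrightarrow> 0 \<le> \<mu> x"
  shows "entropy_form S \<mu> f
    = (\<Sum>i<m. proj_dist \<mu> B i * entropy_form (B i) (restr_dist \<mu> B i) f)
      + entropy_form {..<m} (proj_dist \<mu> B) (block_norm \<mu> B f)"
proof -
  have sub: "B i \<subseteq> S" if "i < m" for i using part that by (auto simp: block_partition_def)
  have finB: "finite (B i)" if "i < m" for i using sub[OF that] fin by (rule finite_subset)
  have posB: "0 \<le> \<mu> x" if "i < m" "x \<in> B i" for i x using that sub pos by blast
  define F where "F = block_norm \<mu> B f"
  define M where "M = expect S \<mu> (\<lambda>x. (f x)\<^sup>2)"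
  have F2: "(F i)\<^sup>2 = expect (B i) (restr_dist \<mu> B i) (\<lambda>x. (f x)\<^sup>2)" if "i < m" for i
    unfolding F_def using posB[OF that] by (rule block_norm_power2)
  have mass: "proj_dist \<mu> B i * (F i)\<^sup>2 = (\<Sum>x\<in>B i. \<mu> x * (f x)\<^sup>2)" if "i < m" for i
    using F2 finB posB that by (simp add: proj_dist_mult_expect)
  \<comment> \<open>Averaging within blocks preserves the global mean, so \<open>f\<close> and
    \<open>F\<close> have entropies normalised by the same \<open>M\<close>.\<close>
  have M: "expect {..<m} (proj_dist \<mu> B) (\<lambda>i. (F i)\<^sup>2) = M"
    unfolding expect_def M_def block_partition_sum[OF fin part] using mass by simp
  have "entropy_form S \<mu> f = (\<Sum>i<m. \<Sum>x\<in>B i. \<mu> x * ((f x)\<^sup>2 * (ln ((f x)\<^sup>2) - ln M)))"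
    unfolding entropy_form_def M_def[symmetric]
    by (simp add: expect_def block_partition_sum[OF fin part])
  \<comment> \<open>A purely algebraic identity, valid whatever the value of \<open>ln 0\<close>, so
    blocks with \<open>F i = 0\<close> cause no exception.\<close>
  also have "\<dots> = (\<Sum>i<m. (\<Sum>x\<in>B i. \<mu> x * ((f x)\<^sup>2 * (ln ((f x)\<^sup>2) - ln ((F i)\<^sup>2))))
      + (\<Sum>x\<in>B i. \<mu> x * (f x)\<^sup>2) * (ln ((F i)\<^sup>2) - ln M))"
    by (simp add: sum_distrib_right right_diff_distrib sum_subtractf mult.assoc)
  also have "\<dots> = (\<Sum>i<m. proj_dist \<mu> B i * entropy_form (B i) (restr_dist \<mu> B i) f
      + proj_dist \<mu> B i * ((F i)\<^sup>2 * (ln ((F i)\<^sup>2) - ln M)))"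
    by (intro sum.cong refl arg_cong2[of _ _ _ _ "(+)"])
      (simp_all add: entropy_form_def proj_dist_mult_expect finB posB F2[symmetric] mass[symmetric])
  also have "\<dots> = (\<Sum>i<m. proj_dist \<mu> B i * entropy_form (B i) (restr_dist \<mu> B i) f)
      + entropy_form {..<m} (proj_dist \<mu> B) F"
    by (simp add: sum.distrib entropy_form_def M) (simp add: expect_def)
  finally show ?thesis by (simp add: F_def)
qed

text \<open>The restriction chain differs from \<open>P\<close> only on the diagonal, where the
  squared difference is 0.\<close>

lemma proj_dist_mult_dirichlet_form_restr:
  assumes "finite (B i)" and "\<And>x. x \<in> B i \<Longrightarrow> 0 \<le> \<mu> x"
  shows "proj_dist \<mu> B i * dirichlet_form (B i) (restr_dist \<mu> B i) (restr_trans P B i) f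
    = 1 / 2 * (\<Sum>x\<in>B i. \<Sum>y\<in>B i. \<mu> x * P x y * (f x - f y)\<^sup>2)"
proof -
  have "proj_dist \<mu> B i * dirichlet_form (B i) (restr_dist \<mu> B i) (restr_trans P B i) f
      = 1 / 2 * (\<Sum>x\<in>B i. \<Sum>y\<in>B i.
          proj_dist \<mu> B i * restr_dist \<mu> B i x * restr_trans P B i x y * (f x - f y)\<^sup>2)"
    by (simp add: dirichlet_form_def sum_distrib_left mult_ac)
  also have "\<dots> = 1 / 2 * (\<Sum>x\<in>B i. \<Sum>y\<in>B i. \<mu> x * P x y * (f x - f y)\<^sup>2)"
    using assms
    by (intro arg_cong[of _ _ "(*) (1 / 2)"] sum.cong)
      (auto simp: proj_dist_mult_restr_dist restr_trans_def)
  finally show ?thesis .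
qed

text \<open>Zero terms for \<open>i = j\<close> keep the index range rectangular, so the two sums
  over blocks can be exchanged.\<close>

definition cross_dirichlet ::
  "nat \<Rightarrow> (nat \<Rightarrow> 'a set) \<Rightarrow> ('a \<Rightarrow> real) \<Rightarrow> ('a \<Rightarrow> 'a \<Rightarrow> real) \<Rightarrow> ('a \<Rightarrow> real) \<Rightarrow> real" where
  "cross_dirichlet m B \<mu> P f = 1 / 2 * (\<Sum>i<m. \<Sum>j<m.
     if i = j then 0 else \<Sum>x\<in>B i. \<Sum>y\<in>B j. \<mu> x * P x y * (f x - f y)\<^sup>2)"

lemma dirichlet_form_decomposition:
  assumes fin: "finite S" and part: "block_partition S m B" and pos: "\<And>x. x \<in> S \<Longrightarrow> 0 \<le> \<mu> x"
  shows "dirichlet_form S \<mu> P f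
    = (\<Sum>i<m. proj_dist \<mu> B i * dirichlet_form (B i) (restr_dist \<mu> B i) (restr_trans P B i) f)
      + cross_dirichlet m B \<mu> P f"
proof -
  have sub: "B i \<subseteq> S" if "i < m" for i using part that by (auto simp: block_partition_def)
  have finB: "finite (B i)" if "i < m" for i using sub[OF that] fin by (rule finite_subset)
  have posB: "0 \<le> \<mu> x" if "i < m" "x \<in> B i" for i x using that sub pos by blast
  define T where "T = (\<lambda>i j. \<Sum>x\<in>B i. \<Sum>y\<in>B j. \<mu> x * P x y * (f x - f y)\<^sup>2)"
  have "dirichlet_form S \<mu> P f
      = 1 / 2 * (\<Sum>i<m. \<Sum>x\<in>B i. \<Sum>j<m. \<Sum>y\<in>B j. \<mu> x * P x y * (f x - f y)\<^sup>2)"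
    by (simp add: dirichlet_form_def block_partition_sum[OF fin part])
  also have "\<dots> = 1 / 2 * (\<Sum>i<m. \<Sum>j<m. T i j)"
    by (subst sum.swap) (simp add: T_def)
  also have "(\<Sum>i<m. \<Sum>j<m. T i j) = (\<Sum>i<m. T i i + (\<Sum>j<m. if i = j then 0 else T i j))"
  proof (intro sum.cong refl)
    fix i assume "i \<in> {..<m}"
    then show "(\<Sum>j<m. T i j) = T i i + (\<Sum>j<m. if i = j then 0 else T i j)"
      by (subst (1 2) sum.remove[of _ i]) (auto intro!: sum.cong)
  qed
  also have "1 / 2 * \<dots> = (\<Sum>i<m. 1 / 2 * T i i) + cross_dirichlet m B \<mu> P f"
    unfolding cross_dirichlet_def T_def by (simp add: sum.distrib sum_distrib_left distrib_left)
  also have "(\<Sum>i<m. 1 / 2 * T i i)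
      = (\<Sum>i<m. proj_dist \<mu> B i * dirichlet_form (B i) (restr_dist \<mu> B i) (restr_trans P B i) f)"
    unfolding T_def using finB posB
    by (intro sum.cong refl proj_dist_mult_dirichlet_form_restr[symmetric]) auto
  finally show ?thesis .
qed

lemma cross_dirichlet_nonneg:
  assumes "\<And>i x. i < m \<Longrightarrow> x \<in> B i \<Longrightarrow> 0 \<le> \<mu> x"
    and "\<And>i j x y. i < m \<Longrightarrow> j < m \<Longrightarrow> x \<in> B i \<Longrightarrow> y \<in> B j \<Longrightarrow> 0 \<le> P x y"
  shows "0 \<le> cross_dirichlet m B \<mu> P f"
  unfolding cross_dirichlet_def using assms by (auto intro!: sum_nonneg mult_nonneg_nonneg)

section \<open>Comparison of the projection chain with the original chain\<close>

text \<open>Split \<open>a - b\<close> through \<open>\<bar>s\<bar>\<close> and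
  \<open>\<bar>t\<bar>\<close>, use Cauchy-Schwarz for three summands, then the reverse triangle
  inequality. The factor 3 here is the 3 in the final constant.\<close>

lemma power2_diff_abs_le:
  fixes a b s t :: real
  shows "(a - b)\<^sup>2 \<le> 3 * ((s - t)\<^sup>2 + (a - \<bar>s\<bar>)\<^sup>2 + (b - \<bar>t\<bar>)\<^sup>2)"
proof -
  have "(u + v + w)\<^sup>2 \<le> 3 * (u\<^sup>2 + v\<^sup>2 + w\<^sup>2)" for u v w :: real
    using zero_le_power2[of "u - v"] zero_le_power2[of "v - w"] zero_le_power2[of "u - w"]
    by (simp add: power2_eq_square algebra_simps)
  from this[of "\<bar>s\<bar> - \<bar>t\<bar>" "a - \<bar>s\<bar>" "\<bar>t\<bar> - b"]
  have "(a - b)\<^sup>2 \<le> 3 * ((\<bar>s\<bar> - \<bar>t\<bar>)\<^sup>2 + (a - \<bar>s\<bar>)\<^sup>2 + (b - \<bar>t\<bar>)\<^sup>2)"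
    by (simp add: power2_commute[of "\<bar>t\<bar>" b])
  also have "\<dots> \<le> 3 * ((s - t)\<^sup>2 + (a - \<bar>s\<bar>)\<^sup>2 + (b - \<bar>t\<bar>)\<^sup>2)"
    using abs_triangle_ineq3[of s t]
    by (intro mult_left_mono add_right_mono) (simp_all add: abs_le_square_iff)
  finally show ?thesis .
qed

text \<open>The comparison is made pair by pair and works for any \<open>F\<close>; block norms
  matter only when the last sum is turned into entropy.\<close>

lemma dirichlet_form_proj_le:
  fixes F :: "nat \<Rightarrow> real"
  assumes fin: "finite S" and part: "block_partition S m B"
    and pos: "\<And>x. x \<in> S \<Longrightarrow> 0 \<le> \<mu> x" and P: "\<And>x y. x \<in> S \<Longrightarrow> y \<in> S \<Longrightarrow> 0 \<le> P x y"
    and rev: "time_reversible S \<mu> P"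
    and exit: "\<And>i x. i < m \<Longrightarrow> x \<in> B i \<Longrightarrow> (\<Sum>y\<in>S - B i. P x y) \<le> c"
  shows "dirichlet_form {..<m} (proj_dist \<mu> B) (proj_trans \<mu> P B) F
    \<le> 3 * cross_dirichlet m B \<mu> P f + 3 * c * (\<Sum>i<m. \<Sum>x\<in>B i. \<mu> x * (F i - \<bar>f x\<bar>)\<^sup>2)"
proof -
  have sub: "B i \<subseteq> S" if "i < m" for i using part that by (auto simp: block_partition_def)
  have finB: "finite (B i)" if "i < m" for i using sub[OF that] fin by (rule finite_subset)
  have posB: "0 \<le> \<mu> x" if "i < m" "x \<in> B i" for i x using that sub pos by blast
  have PB: "0 \<le> P x y" if "i < m" "j < m" "x \<in> B i" "y \<in> B j" for i j x y
    using that sub P by blast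
  \<comment> \<open>\<open>T\<close> integrates \<open>g\<close> over the flow between distinct
    blocks; the Dirichlet forms and error terms below are all instances of it.\<close>
  define T where "T = (\<lambda>g. \<Sum>i<m. \<Sum>j<m. if i = j then 0 else
    \<Sum>x\<in>B i. \<Sum>y\<in>B j. \<mu> x * P x y * (g i j x y :: real))"
  define out where "out = T (\<lambda>i j x y. (F i - \<bar>f x\<bar>)\<^sup>2)"
  have cross: "cross_dirichlet m B \<mu> P f = 1 / 2 * T (\<lambda>i j x y. (f x - f y)\<^sup>2)"
    by (simp add: cross_dirichlet_def T_def)
  \<comment> \<open>Exchanging the endpoints turns the error at \<open>y\<close> into the error at
    \<open>x\<close>, and reversibility says that the flow is unchanged.\<close>
  have swap: "T (\<lambda>i j x y. (F j - \<bar>f y\<bar>)\<^sup>2) = out"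
  proof -
    have "T (\<lambda>i j x y. (F j - \<bar>f y\<bar>)\<^sup>2) = (\<Sum>j<m. \<Sum>i<m. if i = j then 0 else
        \<Sum>y\<in>B j. \<Sum>x\<in>B i. \<mu> x * P x y * (F j - \<bar>f y\<bar>)\<^sup>2)"
      unfolding T_def by (subst sum.swap) (intro sum.cong refl if_cong sum.swap)
    also have "\<dots> = out"
      unfolding out_def T_def
    proof (intro sum.cong refl if_cong)
      fix i j x y assume "j \<in> {..<m}" "i \<in> {..<m}" "x \<in> B i" "y \<in> B j"
      then have "\<mu> x * P x y = \<mu> y * P y x"
        using rev sub by (auto simp: time_reversible_def)
      then show "\<mu> x * P x y * (F j - \<bar>f y\<bar>)\<^sup>2 = \<mu> y * P y x * (F j - \<bar>f y\<bar>)\<^sup>2" by simp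
    qed auto
    finally show ?thesis .
  qed
  \<comment> \<open>Dropping \<open>i = j\<close> is harmless, since \<open>F i - F j\<close>
    vanishes there.\<close>
  have "dirichlet_form {..<m} (proj_dist \<mu> B) (proj_trans \<mu> P B) F
      = 1 / 2 * T (\<lambda>i j x y. (F i - F j)\<^sup>2)"
    unfolding dirichlet_form_def T_def using finB posB
    by (intro arg_cong[of _ _ "(*) (1 / 2)"] sum.cong refl)
      (simp add: proj_dist_mult_proj_trans sum_distrib_right)
  also have "\<dots> \<le> 1 / 2 * T (\<lambda>i j x y.
      3 * ((f x - f y)\<^sup>2 + (F i - \<bar>f x\<bar>)\<^sup>2 + (F j - \<bar>f y\<bar>)\<^sup>2))"
  proof -
    have "T (\<lambda>i j x y. (F i - F j)\<^sup>2)
        \<le> T (\<lambda>i j x y. 3 * ((f x - f y)\<^sup>2 + (F i - \<bar>f x\<bar>)\<^sup>2 + (F j - \<bar>f y\<bar>)\<^sup>2))"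
      unfolding T_def
    proof (rule sum_mono, rule sum_mono)
      fix i j assume ij: "i \<in> {..<m}" "j \<in> {..<m}"
      then have "(\<Sum>x\<in>B i. \<Sum>y\<in>B j. \<mu> x * P x y * (F i - F j)\<^sup>2) \<le> (\<Sum>x\<in>B i. \<Sum>y\<in>B j.
          \<mu> x * P x y * (3 * ((f x - f y)\<^sup>2 + (F i - \<bar>f x\<bar>)\<^sup>2 + (F j - \<bar>f y\<bar>)\<^sup>2)))"
        by (intro sum_mono mult_left_mono[OF power2_diff_abs_le] mult_nonneg_nonneg)
          (auto intro: posB PB)
      then show "(if i = j then 0 else \<Sum>x\<in>B i. \<Sum>y\<in>B j. \<mu> x * P x y * (F i - F j)\<^sup>2)
          \<le> (if i = j then 0 else \<Sum>x\<in>B i. \<Sum>y\<in>B j.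
            \<mu> x * P x y * (3 * ((f x - f y)\<^sup>2 + (F i - \<bar>f x\<bar>)\<^sup>2 + (F j - \<bar>f y\<bar>)\<^sup>2)))"
        by simp
    qed
    then show ?thesis by simp
  qed
  also have "T (\<lambda>i j x y. 3 * ((f x - f y)\<^sup>2 + (F i - \<bar>f x\<bar>)\<^sup>2 + (F j - \<bar>f y\<bar>)\<^sup>2))
      = 3 * (T (\<lambda>i j x y. (f x - f y)\<^sup>2) + T (\<lambda>i j x y. (F i - \<bar>f x\<bar>)\<^sup>2)
        + T (\<lambda>i j x y. (F j - \<bar>f y\<bar>)\<^sup>2))"
    unfolding T_def sum.distrib[symmetric] sum_distrib_left
    by (intro sum.cong refl) (simp add: sum.distrib sum_distrib_left distrib_left mult_ac)
  \<comment> \<open>The two equal error terms cancel the factor 1/2, so \<open>out\<close> keeps the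
    full coefficient 3.\<close>
  also have "1 / 2 * \<dots> = 3 * cross_dirichlet m B \<mu> P f + 3 * out"
    unfolding cross swap out_def[symmetric] by simp
  also have "out \<le> c * (\<Sum>i<m. \<Sum>x\<in>B i. \<mu> x * (F i - \<bar>f x\<bar>)\<^sup>2)"
  proof -
    \<comment> \<open>The error at \<open>x\<close> does not depend on \<open>y\<close>, so summing
      over \<open>y\<close> leaves the probability of exit from the block of
      \<open>x\<close>.\<close>
    have "out = (\<Sum>i<m. \<Sum>x\<in>B i. (\<Sum>y\<in>S - B i. P x y) * (\<mu> x * (F i - \<bar>f x\<bar>)\<^sup>2))"
      unfolding out_def T_def
    proof (intro sum.cong refl)
      fix i assume "i \<in> {..<m}"
      then have "(\<Sum>x\<in>B i. (\<Sum>y\<in>S - B i. P x y) * (\<mu> x * (F i - \<bar>f x\<bar>)\<^sup>2))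
          = (\<Sum>x\<in>B i. \<Sum>j<m. if i = j then 0 else
              (\<Sum>y\<in>B j. \<mu> x * P x y * (F i - \<bar>f x\<bar>)\<^sup>2))"
        unfolding block_partition_sum_Diff[OF fin part \<open>i \<in> {..<m}\<close>[simplified]] sum_distrib_right
        by (intro sum.cong refl) (simp add: sum_distrib_left sum_distrib_right mult_ac)
      also have "\<dots> = (\<Sum>j<m. if i = j then 0 else
          \<Sum>x\<in>B i. \<Sum>y\<in>B j. \<mu> x * P x y * (F i - \<bar>f x\<bar>)\<^sup>2)"
        by (subst sum.swap) (auto intro!: sum.cong)
      finally show "(\<Sum>j<m. if i = j then 0 else
          \<Sum>x\<in>B i. \<Sum>y\<in>B j. \<mu> x * P x y * (F i - \<bar>f x\<bar>)\<^sup>2)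
        = (\<Sum>x\<in>B i. (\<Sum>y\<in>S - B i. P x y) * (\<mu> x * (F i - \<bar>f x\<bar>)\<^sup>2))" ..
    qed
    also have "\<dots> \<le> (\<Sum>i<m. \<Sum>x\<in>B i. c * (\<mu> x * (F i - \<bar>f x\<bar>)\<^sup>2))"
      by (intro sum_mono mult_right_mono exit mult_nonneg_nonneg) (auto intro: posB)
    finally show ?thesis by (simp add: sum_distrib_left)
  qed
  finally show ?thesis by simp
qed

section \<open>Combination of the inequalities and choice of the constant\<close>

theorem theorem4:
  fixes \<Omega> :: "'a set" and P :: "'a \<Rightarrow> 'a \<Rightarrow> real" and \<pi> :: "'a \<Rightarrow> real"
    and m :: nat and B :: "nat \<Rightarrow> 'a set"
    and alpha_bar alpha_min gamma alpha :: real
  assumes "transition_matrix \<Omega> P"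
    and "stationary_distribution \<Omega> \<pi> P"
    and "ergodic_chain \<Omega> P"
    and "time_reversible \<Omega> \<pi> P"
    and "block_partition \<Omega> m B"
    and "alpha_bar > 0"
    and "log_sobolev {..<m} (proj_dist \<pi> B) (proj_trans \<pi> P B) alpha_bar"
    and "alpha_min > 0"
    and "\<And>i. i < m \<Longrightarrow> log_sobolev (B i) (restr_dist \<pi> B i) (restr_trans P B i) alpha_min"
    and "gamma = (MAX i\<in>{..<m}. MAX x\<in>B i. \<Sum>y\<in>\<Omega> - B i. P x y)"
    and "alpha = min (alpha_bar / 3) (alpha_bar * alpha_min / (3 * gamma + alpha_bar))"
  shows "log_sobolev \<Omega> \<pi> P alpha"
  unfolding log_sobolev_def
proof
  fix f :: "'a \<Rightarrow> real"
  have fin: "finite \<Omega>" and ne: "\<Omega> \<noteq> {}" and P: "\<And>x y. x \<in> \<Omega> \<Longrightarrow> y \<in> \<Omega> \<Longrightarrow> 0 \<le> P x y"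
    using assms(1) by (auto simp: transition_matrix_def)
  have pos: "\<And>x. x \<in> \<Omega> \<Longrightarrow> 0 \<le> \<pi> x"
    using assms(2) by (auto simp: stationary_distribution_def)
  note part = assms(5)
  have sub: "B i \<subseteq> \<Omega>" if "i < m" for i using part that by (auto simp: block_partition_def)
  have finB: "finite (B i)" if "i < m" for i using sub[OF that] fin by (rule finite_subset)
  have posB: "0 \<le> \<pi> x" if "i < m" "x \<in> B i" for i x using that sub pos by blast
  have exit: "(\<Sum>y\<in>\<Omega> - B i. P x y) \<le> gamma" if "i < m" "x \<in> B i" for i x
  proof -
    have "(\<Sum>y\<in>\<Omega> - B i. P x y) \<le> (MAX x\<in>B i. \<Sum>y\<in>\<Omega> - B i. P x y)"
      using that finB by (intro Max_ge) auto
    also have "\<dots> \<le> gamma"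
      unfolding assms(10) using that by (intro Max_ge) auto
    finally show ?thesis .
  qed
  \<comment> \<open>Needed for a positive denominator \<open>3 * gamma + alpha_bar\<close> and for
    replacing \<open>V\<close> by the larger \<open>A\<close>.\<close>
  have gamma: "0 \<le> gamma"
  proof -
    obtain i x where ix: "i < m" "x \<in> B i"
      using ne part by (auto simp: block_partition_def)
    then have "0 \<le> (\<Sum>y\<in>\<Omega> - B i. P x y)"
      using sub by (intro sum_nonneg P) auto
    with exit[OF ix] show ?thesis by linarith
  qed
  define p where "p = proj_dist \<pi> B"
  define F where "F = block_norm \<pi> B f"
  define A where "A = (\<Sum>i<m. p i * entropy_form (B i) (restr_dist \<pi> B i) f)"
  define L where "L = entropy_form {..<m} p F"
  define W where "W = (\<Sum>i<m. p i * dirichlet_form (B i) (restr_dist \<pi> B i) (restr_trans P B i) f)"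
  define X where "X = cross_dirichlet m B \<pi> P f"
  define V where "V = (\<Sum>i<m. \<Sum>x\<in>B i. \<pi> x * (F i - \<bar>f x\<bar>)\<^sup>2)"
  have p: "0 \<le> p i" if "i < m" for i
    unfolding p_def proj_dist_def using posB[OF that] by (rule sum_nonneg)
  have VA: "V \<le> A"
    unfolding V_def A_def F_def p_def using finB posB
    by (intro sum_mono block_deviation_le_entropy_form) auto
  have V0: "0 \<le> V"
    unfolding V_def using posB by (auto intro!: sum_nonneg)
  have X0: "0 \<le> X"
    unfolding X_def using posB P sub by (intro cross_dirichlet_nonneg) blast+
  have AW: "alpha_min * A \<le> W"
    unfolding A_def W_def sum_distrib_left
  proof (rule sum_mono)
    fix i assume "i \<in> {..<m}"
    then show "alpha_min * (p i * entropy_form (B i) (restr_dist \<pi> B i) f)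
        \<le> p i * dirichlet_form (B i) (restr_dist \<pi> B i) (restr_trans P B i) f"
      using mult_left_mono[OF assms(9)[of i, unfolded log_sobolev_def, rule_format, of f] p[of i]]
      by (simp add: mult.left_commute)
  qed
  have "alpha_bar * L \<le> 3 * X + 3 * gamma * V"
  proof -
    have "alpha_bar * L \<le> dirichlet_form {..<m} (proj_dist \<pi> B) (proj_trans \<pi> P B) F"
      using assms(7) by (simp add: log_sobolev_def L_def p_def)
    also have "\<dots> \<le> 3 * X + 3 * gamma * V"
      unfolding X_def V_def by (rule dirichlet_form_proj_le[OF fin part pos P assms(4) exit])
    finally show ?thesis .
  qed
  also have "\<dots> \<le> 3 * X + 3 * gamma * A"
    using VA gamma by (intro add_left_mono mult_left_mono) auto
  \<comment> \<open>Adding \<open>alpha_bar * A\<close> completes \<open>L\<close> to the whole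
    entropy and creates the denominator of the second term of the minimum.\<close>
  finally have LA: "alpha_bar * (A + L) \<le> 3 * X + (3 * gamma + alpha_bar) * A"
    by (simp add: algebra_simps)
  have d: "0 < 3 * gamma + alpha_bar" using gamma assms(6) by simp
  have alpha0: "0 \<le> alpha"
    using assms(6,8) d by (simp add: assms(11))
  \<comment> \<open>Each term of the minimum controls one coefficient: \<open>a1\<close> that of
    \<open>X\<close>, \<open>a2\<close> that of \<open>A\<close>.\<close>
  have a1: "alpha * 3 \<le> alpha_bar"
    using assms(11) by linarith
  have a2: "alpha * (3 * gamma + alpha_bar) \<le> alpha_bar * alpha_min"
    unfolding pos_le_divide_eq[OF d, symmetric] by (simp add: assms(11))
  have "alpha_bar * (alpha * (A + L)) \<le> alpha * (3 * X + (3 * gamma + alpha_bar) * A)"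
    using mult_left_mono[OF LA alpha0] by (simp add: mult_ac)
  also have "\<dots> = (alpha * 3) * X + (alpha * (3 * gamma + alpha_bar)) * A"
    by (simp add: algebra_simps)
  \<comment> \<open>Monotonicity requires \<open>0 \<le> A\<close>, which follows from
    \<open>0 \<le> V\<close> and \<open>V \<le> A\<close>.\<close>
  also have "\<dots> \<le> alpha_bar * X + (alpha_bar * alpha_min) * A"
    using X0 V0 VA by (intro add_mono mult_right_mono a1 a2) auto
  also have "\<dots> \<le> alpha_bar * X + alpha_bar * W"
    using AW assms(6) by (simp add: mult.assoc)
  finally have "alpha_bar * (alpha * (A + L)) \<le> alpha_bar * (W + X)"
    by (simp add: algebra_simps)
  then have "alpha * (A + L) \<le> W + X"
    using assms(6) by simp
  then show "alpha * entropy_form \<Omega> \<pi> f \<le> dirichlet_form \<Omega> \<pi> P f"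
    using entropy_form_decomposition[OF fin part pos, where f = f]
      dirichlet_form_decomposition[OF fin part pos, where P = P and f = f]
    by (simp add: A_def L_def W_def X_def F_def p_def)
qed

end
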